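(* Assume that for some $c>0$ the Poincaré inequality $$\forall f\in\mathcal A,\qquad \int f^2\,d\mu-\Big(\int f\,d\mu\Big)^2\le c\int|\nabla f|^2\,d\mu$$ holds. Assume also that there are a function $M$ on $\Omega$ and constants $\eta,\beta>0$ such that $|\nabla Qf(x)|^2\le M(x)\,Q(|\nabla f|^2)(x)$ for all $f\in\mathcal A$, $x\in\Omega$, and such that for $\mu$-almost all $x\in\Omega$ (with $\lambda(x)>0$ for $\mu$-almost all $x$) and all $u\in\mathbb R^d$, $$u^*\Big(2J_b(x)+\frac{\nabla\lambda(x)(\nabla\lambda(x))^*}{\beta\lambda(x)}\Big)u+\lambda(x)(M(x)-1)|u|^2\le-\eta|u|^2 .$$ For $f\in\mathcal A$ and $t\ge0$ let $W_t=\int|\nabla P_tf|^2d\mu$ and $V_t=\int(P_tf)^2d\mu-\big(\int P_tf\,d\mu\big)^2$. Then for all $f\in\mathcal A$ and $t\ge 0$, $$W_t+\beta V_t\le(W_0+\beta V_0)\,e^{-\frac{\eta t}{\beta c+1}}.$$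
   Context: Setting. $\Omega\subset\mathbb R^d$ is open, $b:\Omega\to\mathbb R^d$ is a smooth vector field, $\lambda:\Omega\to\mathbb R_+$ is a smooth jump rate, and $Q$ is a Markov transition kernel on $\Omega$, also viewed as the operator $Qf(x)=\int f(y)\,Q(x,dy)$. Let $(\varphi_x(t))_{t\ge0}$ solve $\partial_t\varphi_x(t)=b(\varphi_x(t))$, $\varphi_x(0)=x$. The piecewise deterministic Markov process $(X_t)_{t\ge 0}$ started at $x$ follows the flow $\varphi_x$ until a random time $T_x$ with $\mathbb P(T_x<s)=1-e^{-\int_0^s\lambda(\varphi_x(w))dw}$, then jumps according to the law $Q(\varphi_x(T_x))$, and starts anew from its new position. Its generator is $Lf(x)=b(x)\cdot\nabla f(x)+\lambda(x)(Qf(x)-f(x))$, and its semigroup is $P_tf(x)=\mathbb E(f(X_t)\mid X_0=x)$. Standing assumptions: the flow is well-defined for all $t>0$ and stays in $\Omega$; the process is non-explosive; $\lambda>0$ almost everywhere and at every fixed point of the flow; the process has a unique invariant law $\mu$, and $P_tf(x)\to\int f\,d\mu$ as $t\to\infty$ for all $f\in L^2(\mu)$, $x\in\Omega$; all polynomial moments of $\mu$ are finite; with $\mathcal A$ the set of functions in $\mathcal C^\infty(\Omega)$ whose derivatives grow at most polynomially at infinity, $Q$, $L$ and $P_t$ are well-defined on $\mathcal A$ and map $\mathcal A$ to itself. The elementary calculations with functions of $\mathcal A$ (e.g. $\partial_tP_tf=LP_tf=P_tLf$, differentiation under $P_t$ and $\mu$) are taken to be licit. Notation: $J_b(x)=[\partial_ib_k(x)]_{1\le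 i,k\le d}$; $A^*$ is the transpose of $A$, so $u^*v$ is the scalar product; $|\cdot|$ is the Euclidean norm. *)

theory Defs
  imports "HOL-Probability.Probability"
begin

section \<open>Smooth functions with polynomial growth\<close>

definition partial :: "'d::finite \<Rightarrow> (real^'d \<Rightarrow> real) \<Rightarrow> real^'d \<Rightarrow> real" where
  "partial i f x = frechet_derivative f (at x) (axis i 1)"

fun iter_partial :: "'d::finite list \<Rightarrow> (real^'d \<Rightarrow> real) \<Rightarrow> real^'d \<Rightarrow> real" where
  "iter_partial [] f = f"
| "iter_partial (i # js) f = partial i (iter_partial js f)"

definition smooth_on :: "(real^'d::finite) set \<Rightarrow> (real^'d \<Rightarrow> real) \<Rightarrow> bool" where
  "smooth_on \<Omega> f \<longleftrightarrow> (\<forall>js. \<forall>x\<in>\<Omega>. iter_partial js f differentiable at x)"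

definition grad :: "(real^'d::finite \<Rightarrow> real) \<Rightarrow> real^'d \<Rightarrow> real^'d" where
  "grad f x = (\<chi> i. partial i f x)"

text \<open>The class \<open>\<A>\<close>. Functions on \<open>\<Omega>\<close> are total functions whose values off \<open>\<Omega>\<close> are
  irrelevant. The derivatives of all orders, order 0 (the empty list) included, are bounded on
  \<open>\<Omega>\<close> by a polynomial in \<open>norm x\<close>.\<close>

definition poly_smooth :: "(real^'d::finite) set \<Rightarrow> (real^'d \<Rightarrow> real) set" where
  "poly_smooth \<Omega> = {f. smooth_on \<Omega> f \<and>
     (\<forall>js. \<exists>C k. \<forall>x\<in>\<Omega>. \<bar>iter_partial js f x\<bar> \<le> C * (1 + norm x ^ k))}"


section \<open>Piecewise deterministic Markov processes\<close>

definition is_flow :: "'a::real_normed_vector set \<Rightarrow> ('a \<Rightarrow> 'a) \<Rightarrow> ('a \<Rightarrow> real \<Rightarrow> 'a) \<Rightarrow> bool" where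
  "is_flow \<Omega> b \<phi> \<longleftrightarrow> (\<forall>x\<in>\<Omega>. \<phi> x 0 = x \<and>
     (\<forall>t\<ge>0. \<phi> x t \<in> \<Omega> \<and> (\<phi> x has_vector_derivative b (\<phi> x t)) (at t within {0..})))"

text \<open>\<open>Y n\<close> is the position after the \<open>n\<close>-th jump (\<open>Y 0\<close> is the starting point) and \<open>T n\<close> the
  waiting time from then until the next jump, with value \<open>\<infinity>\<close> if there is no further jump.
  The two sigma-algebras below are the history up to and including the \<open>n\<close>-th jump, and
  the same history enlarged by the waiting time that follows.\<close>

definition jump_time :: "(nat \<Rightarrow> 'w \<Rightarrow> ennreal) \<Rightarrow> nat \<Rightarrow> 'w \<Rightarrow> ennreal" where
  "jump_time T n \<omega> = (\<Sum>i<n. T i \<omega>)"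

definition post_jump_history ::
  "'w measure \<Rightarrow> 'a measure \<Rightarrow> (nat \<Rightarrow> 'w \<Rightarrow> 'a) \<Rightarrow> (nat \<Rightarrow> 'w \<Rightarrow> ennreal) \<Rightarrow> nat \<Rightarrow> 'w measure" where
  "post_jump_history N S Y T n = sigma (space N)
     ({Y i -` B \<inter> space N | i B. i \<le> n \<and> B \<in> sets S} \<union>
      {T i -` B \<inter> space N | i B. i < n \<and> B \<in> sets borel})"

definition pre_jump_history ::
  "'w measure \<Rightarrow> 'a measure \<Rightarrow> (nat \<Rightarrow> 'w \<Rightarrow> 'a) \<Rightarrow> (nat \<Rightarrow> 'w \<Rightarrow> ennreal) \<Rightarrow> nat \<Rightarrow> 'w measure" where
  "pre_jump_history N S Y T n = sigma (space N)
     ({Y i -` B \<inter> space N | i B. i \<le> n \<and> B \<in> sets S} \<union>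
      {T i -` B \<inter> space N | i B. i \<le> n \<and> B \<in> sets borel})"

text \<open>\<open>X\<close> is a PDMP started at \<open>x\<close> under \<open>N\<close>: given the past, the waiting time from \<open>y = Y n\<close>
  has distribution function \<open>1 - exp (- \<integral>\<^sub>0\<^sup>s \<lambda>(\<phi>\<^sub>y(w)) dw)\<close>, the next position has law
  \<open>Q (\<phi>\<^sub>y(T n))\<close>, and \<open>X\<close> follows the flow between jumps.\<close>

definition is_pdmp ::
  "(real^'d::finite) set \<Rightarrow> (real^'d \<Rightarrow> real \<Rightarrow> real^'d) \<Rightarrow> (real^'d \<Rightarrow> real) \<Rightarrow>
   (real^'d \<Rightarrow> (real^'d) measure) \<Rightarrow> 'w measure \<Rightarrow> (real \<Rightarrow> 'w \<Rightarrow> real^'d) \<Rightarrow>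
   (nat \<Rightarrow> 'w \<Rightarrow> real^'d) \<Rightarrow> (nat \<Rightarrow> 'w \<Rightarrow> ennreal) \<Rightarrow> real^'d \<Rightarrow> bool" where
  "is_pdmp \<Omega> \<phi> lam Q N X Y T x \<longleftrightarrow>
     prob_space N \<and>
     (\<forall>t\<ge>0. X t \<in> N \<rightarrow>\<^sub>M restrict_space borel \<Omega>) \<and>
     (\<forall>n. Y n \<in> N \<rightarrow>\<^sub>M restrict_space borel \<Omega>) \<and>
     (\<forall>n. T n \<in> N \<rightarrow>\<^sub>M borel) \<and>
     (AE \<omega> in N. Y 0 \<omega> = x) \<and>
     (\<forall>n. \<forall>s\<ge>0. AE \<omega> in N.
        real_cond_exp N (post_jump_history N (restrict_space borel \<Omega>) Y T n)
          (indicat_real {\<omega>\<in>space N. T n \<omega> < ennreal s}) \<omega>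
        = 1 - exp (- integral {0..s} (\<lambda>w. lam (\<phi> (Y n \<omega>) w)))) \<and>
     (\<forall>n. \<forall>B\<in>sets (restrict_space borel \<Omega>). AE \<omega> in N. T n \<omega> < \<infinity> \<longrightarrow>
        real_cond_exp N (pre_jump_history N (restrict_space borel \<Omega>) Y T n)
          (indicat_real {\<omega>\<in>space N. Y (Suc n) \<omega> \<in> B}) \<omega>
        = measure (Q (\<phi> (Y n \<omega>) (enn2real (T n \<omega>)))) B) \<and>
     (AE \<omega> in N. \<forall>n. \<forall>t\<ge>0.
        jump_time T n \<omega> \<le> ennreal t \<and> ennreal t < jump_time T (Suc n) \<omega> \<longrightarrow>
        X t \<omega> = \<phi> (Y n \<omega>) (t - enn2real (jump_time T n \<omega>)))"

definition kernel_op :: "('a \<Rightarrow> 'a measure) \<Rightarrow> ('a \<Rightarrow> real) \<Rightarrow> 'a \<Rightarrow> real" where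
  "kernel_op Q f x = (\<integral>y. f y \<partial>Q x)"

definition generator ::
  "(real^'d::finite \<Rightarrow> real^'d) \<Rightarrow> (real^'d \<Rightarrow> real) \<Rightarrow> (real^'d \<Rightarrow> (real^'d) measure) \<Rightarrow>
   (real^'d \<Rightarrow> real) \<Rightarrow> real^'d \<Rightarrow> real" where
  "generator b lam Q f x = b x \<bullet> grad f x + lam x * (kernel_op Q f x - f x)"

text \<open>\<open>Pr x\<close> is the law under which the process starts at \<open>x\<close>.\<close>

definition transition_op ::
  "('a \<Rightarrow> 'w measure) \<Rightarrow> (real \<Rightarrow> 'w \<Rightarrow> 'a) \<Rightarrow> real \<Rightarrow> ('a \<Rightarrow> real) \<Rightarrow> 'a \<Rightarrow> real" where
  "transition_op Pr X t f x = (\<integral>\<omega>. f (X t \<omega>) \<partial>Pr x)"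

definition invariant_law ::
  "'a::topological_space set \<Rightarrow> (real \<Rightarrow> ('a \<Rightarrow> real) \<Rightarrow> 'a \<Rightarrow> real) \<Rightarrow> 'a measure \<Rightarrow> bool" where
  "invariant_law \<Omega> P \<nu> \<longleftrightarrow> prob_space \<nu> \<and> sets \<nu> = sets (restrict_space borel \<Omega>) \<and>
     (\<forall>t\<ge>0. \<forall>B\<in>sets \<nu>. (\<integral>x. P t (indicat_real B) x \<partial>\<nu>) = measure \<nu> B)"

definition diff_under_integral :: "'a measure \<Rightarrow> (real \<Rightarrow> 'a \<Rightarrow> real) \<Rightarrow> bool" where
  "diff_under_integral \<nu> F \<longleftrightarrow> (\<forall>t\<ge>0.
     ((\<lambda>s. \<integral>x. F s x \<partial>\<nu>) has_real_derivative
        (\<integral>x. vector_derivative (\<lambda>s. F s x) (at t within {0..}) \<partial>\<nu>)) (at t within {0..}))"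


section \<open>Standing assumptions\<close>

text \<open>Convergence to equilibrium (\<open>ergodic\<close>) is only required for \<open>f\<close> in the class \<open>\<A>\<close>, which is
  contained in \<open>L\<^sup>2(\<mu>)\<close> because \<open>\<mu>\<close> has polynomial moments. This is weaker than
  requiring it for all of \<open>L\<^sup>2(\<mu>)\<close>. For an equivalence class of functions modulo \<open>\<mu>\<close>-null sets
  the pointwise value \<open>P\<^sub>t f(x)\<close> need not be defined, as the law of \<open>X\<^sub>t\<close> started at \<open>x\<close> has an atom
  at \<open>\<phi>\<^sub>x(t)\<close>.

  The assumptions \<open>time_deriv\<close>, \<open>time_deriv_grad\<close> and \<open>under_mu\<close> are the calculus rules for functions
  of \<open>\<A>\<close> that are taken for granted: the evolution equations, the exchange of
  \<open>\<partial>\<^sub>t\<close> and \<open>\<nabla>\<close>, and differentiation under \<open>\<mu>\<close>.\<close>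

locale pdmp_setting =
  fixes \<Omega> :: "(real^'d::finite) set"
    and b :: "real^'d \<Rightarrow> real^'d"
    and lam :: "real^'d \<Rightarrow> real"
    and Q :: "real^'d \<Rightarrow> (real^'d) measure"
    and \<phi> :: "real^'d \<Rightarrow> real \<Rightarrow> real^'d"
    and Pr :: "real^'d \<Rightarrow> 'w measure"
    and X :: "real \<Rightarrow> 'w \<Rightarrow> real^'d"
    and Y :: "nat \<Rightarrow> 'w \<Rightarrow> real^'d"
    and T :: "nat \<Rightarrow> 'w \<Rightarrow> ennreal"
    and \<mu> :: "(real^'d) measure"
  assumes open_domain: "open \<Omega>"
    and smooth_field: "\<And>k. smooth_on \<Omega> (\<lambda>x. b x $ k)"
    and smooth_rate: "smooth_on \<Omega> lam"
    and rate_nonneg: "\<And>x. x \<in> \<Omega> \<Longrightarrow> lam x \<ge> 0"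
    and markov_kernel: "Q \<in> restrict_space borel \<Omega> \<rightarrow>\<^sub>M prob_algebra (restrict_space borel \<Omega>)"
    and flow: "is_flow \<Omega> b \<phi>"
    and process: "\<And>x. x \<in> \<Omega> \<Longrightarrow> is_pdmp \<Omega> \<phi> lam Q (Pr x) X Y T x"
    and non_explosive: "\<And>x. x \<in> \<Omega> \<Longrightarrow> AE \<omega> in Pr x. (\<Sum>n. T n \<omega>) = \<infinity>"
    and rate_pos_ae: "AE x in lborel. x \<in> \<Omega> \<longrightarrow> lam x > 0"
    and rate_pos_fixed: "\<And>x. x \<in> \<Omega> \<Longrightarrow> (\<forall>t\<ge>0. \<phi> x t = x) \<Longrightarrow> lam x > 0"
    and invariant: "invariant_law \<Omega> (transition_op Pr X) \<mu>"
    and unique_invariant: "\<And>\<nu>. invariant_law \<Omega> (transition_op Pr X) \<nu> \<Longrightarrow> \<nu> = \<mu>"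
    and ergodic: "\<And>f x. f \<in> poly_smooth \<Omega> \<Longrightarrow> x \<in> \<Omega> \<Longrightarrow>
          ((\<lambda>t. transition_op Pr X t f x) \<longlongrightarrow> (\<integral>y. f y \<partial>\<mu>)) at_top"
    and moments: "\<And>k. integrable \<mu> (\<lambda>x. norm x ^ k)"
    and Q_defined: "\<And>f x. f \<in> poly_smooth \<Omega> \<Longrightarrow> x \<in> \<Omega> \<Longrightarrow> integrable (Q x) f"
    and P_defined: "\<And>f x t. f \<in> poly_smooth \<Omega> \<Longrightarrow> x \<in> \<Omega> \<Longrightarrow> t \<ge> 0 \<Longrightarrow>
          integrable (Pr x) (\<lambda>\<omega>. f (X t \<omega>))"
    and Q_closed: "\<And>f. f \<in> poly_smooth \<Omega> \<Longrightarrow> kernel_op Q f \<in> poly_smooth \<Omega>"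
    and L_closed: "\<And>f. f \<in> poly_smooth \<Omega> \<Longrightarrow> generator b lam Q f \<in> poly_smooth \<Omega>"
    and P_closed: "\<And>f t. f \<in> poly_smooth \<Omega> \<Longrightarrow> t \<ge> 0 \<Longrightarrow> transition_op Pr X t f \<in> poly_smooth \<Omega>"
    and time_deriv: "\<And>f x t. f \<in> poly_smooth \<Omega> \<Longrightarrow> x \<in> \<Omega> \<Longrightarrow> t \<ge> 0 \<Longrightarrow>
          ((\<lambda>s. transition_op Pr X s f x) has_real_derivative
             generator b lam Q (transition_op Pr X t f) x) (at t within {0..}) \<and>
          generator b lam Q (transition_op Pr X t f) x = transition_op Pr X t (generator b lam Q f) x"
    and time_deriv_grad: "\<And>f x t. f \<in> poly_smooth \<Omega> \<Longrightarrow> x \<in> \<Omega> \<Longrightarrow> t \<ge> 0 \<Longrightarrow>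
          ((\<lambda>s. grad (transition_op Pr X s f) x) has_vector_derivative
             grad (generator b lam Q (transition_op Pr X t f)) x) (at t within {0..})"
    and under_mu: "\<And>f. f \<in> poly_smooth \<Omega> \<Longrightarrow>
          diff_under_integral \<mu> (\<lambda>t. transition_op Pr X t f) \<and>
          diff_under_integral \<mu> (\<lambda>t x. (transition_op Pr X t f x)\<^sup>2) \<and>
          diff_under_integral \<mu> (\<lambda>t x. (norm (grad (transition_op Pr X t f) x))\<^sup>2)"


section \<open>The curvature matrix\<close>

text \<open>The entry \<open>(i, k)\<close> of \<open>J\<^sub>b\<close> is \<open>\<partial>\<^sub>i b\<^sub>k\<close>, whereas that of the library's \<open>jacobian\<close> is \<open>\<partial>\<^sub>k b\<^sub>i\<close>.\<close>

definition Jac :: "(real^'d::finite \<Rightarrow> real^'d) \<Rightarrow> real^'d \<Rightarrow> real^'d^'d" where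
  "Jac b x = transpose (jacobian b (at x))"

definition outer :: "real^'d::finite \<Rightarrow> real^'d \<Rightarrow> real^'d^'d" where
  "outer u v = (\<chi> i k. u $ i * v $ k)"

end

theory Submission
  imports Defs
begin

text \<open>
  Write \<open>f\<^sub>t = P\<^sub>t f\<close>. Since \<open>\<partial>\<^sub>t f\<^sub>t = L f\<^sub>t\<close>, the time derivatives of \<open>W\<close> and \<open>V\<close> are
  \<open>\<integral> 2 \<nabla>f\<^sub>t \<bullet> \<nabla>L f\<^sub>t d\<mu>\<close> and \<open>\<integral> 2 f\<^sub>t L f\<^sub>t d\<mu>\<close>. Invariance of \<open>\<mu>\<close> gives \<open>\<integral> L g d\<mu> = 0\<close> for every
  \<open>g\<close> of the class (\<open>integral_generator\<close>), so \<open>L |\<nabla>f\<^sub>t|\<^sup>2\<close> and \<open>L f\<^sub>t\<^sup>2\<close> may be subtracted from the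
  integrands. This is what makes them computable pointwise, in the manner of Bakry and Emery: the
  second derivatives of \<open>f\<^sub>t\<close> along the drift cancel, and there remains
  \<open>2 f L f - L f\<^sup>2 = - \<lambda> (Q f\<^sup>2 - 2 f Q f + f\<^sup>2) \<le> - \<lambda> (Q f - f)\<^sup>2\<close> together with
  \<open>2 \<nabla>f \<bullet> J\<^sub>b \<nabla>f + 2 (Q f - f) \<nabla>\<lambda> \<bullet> \<nabla>f + \<lambda> (2 \<nabla>f \<bullet> \<nabla>Q f - |\<nabla>f|\<^sup>2 - Q |\<nabla>f|\<^sup>2)\<close>.

  In the last expression the contraction of \<open>Q\<close> bounds \<open>2 \<nabla>f \<bullet> \<nabla>Q f\<close> by \<open>M |\<nabla>f|\<^sup>2 + Q |\<nabla>f|\<^sup>2\<close>.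
  The only term that a gradient estimate cannot absorb is the one with \<open>Q f - f\<close>. By Young's inequality
  it is at most \<open>(\<nabla>\<lambda> \<bullet> \<nabla>f)\<^sup>2 / (\<beta> \<lambda>) + \<beta> \<lambda> (Q f - f)\<^sup>2\<close>; the first half is part of the curvature
  hypothesis, and the second half is exactly what \<open>\<beta>\<close> times the dissipation of the variance pays
  for. Thus \<open>W' + \<beta> V' \<le> - \<eta> W\<close> (\<open>dissipation_pointwise\<close>, \<open>dissipation_integrated\<close>). The Poincare
  inequality gives \<open>W + \<beta> V \<le> (1 + \<beta> c) W\<close>, and Gronwall's lemma (\<open>exp_decay_of_deriv_le\<close>)
  concludes.

  Two points need preparation. The computation applies \<open>L\<close> to \<open>f\<^sup>2\<close> and \<open>|\<nabla>f|\<^sup>2\<close>, so the class must be an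
  algebra closed under partial derivatives (\<open>poly_smooth_alg_eq\<close>), and the cancellation needs the
  symmetry of second derivatives (\<open>partial_commute\<close>). And invariance is given for indicator
  functions only, so it has to be extended to integrable functions (\<open>invariant_kernel_integral\<close>).
\<close>

section \<open>Partial derivatives\<close>

lemma partial_eqI:
  assumes "(f has_derivative f') (at x)"
  shows "partial i f x = f' (axis i 1)"
  using frechet_derivative_at[OF assms] by (simp add: partial_def)

lemma differentiable_cong_open:
  assumes "open \<Omega>" "x \<in> \<Omega>" "\<And>y. y \<in> \<Omega> \<Longrightarrow> f y = g y"
  shows "f differentiable (at x) \<longleftrightarrow> g differentiable (at x)"
  unfolding differentiable_def
  using has_derivative_transform_within_open[OF _ assms(1,2), of f _ UNIV g]
    has_derivative_transform_within_open[OF _ assms(1,2), of g _ UNIV f] assms(3)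
  by metis

lemma partial_cong_open:
  assumes "open \<Omega>" "x \<in> \<Omega>" "\<And>y. y \<in> \<Omega> \<Longrightarrow> f y = g y"
  shows "partial i f x = partial i g x"
proof -
  have "(f has_derivative f') (at x) \<longleftrightarrow> (g has_derivative f') (at x)" for f'
    using has_derivative_transform_within_open[OF _ assms(1,2), of f f' UNIV g]
      has_derivative_transform_within_open[OF _ assms(1,2), of g f' UNIV f] assms(3)
    by metis
  then show ?thesis
    by (simp add: partial_def frechet_derivative_def)
qed

text \<open>\<open>iter_partial\<close> adds new derivatives on the outside; closure of a smoothness class under a
  single derivative needs them on the inside.\<close>
lemma iter_partial_append:
  "iter_partial (js @ [i]) f = iter_partial js (partial i f)"
  by (induction js) auto

lemma partial_add:
  assumes "f differentiable (at x)" "g differentiable (at x)"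
  shows "partial i (\<lambda>y. f y + g y) x = partial i f x + partial i g x"
  using assms unfolding frechet_derivative_works
  by (subst partial_eqI[OF has_derivative_add]) (auto simp: partial_def)

lemma partial_diff:
  assumes "f differentiable (at x)" "g differentiable (at x)"
  shows "partial i (\<lambda>y. f y - g y) x = partial i f x - partial i g x"
  using assms unfolding frechet_derivative_works
  by (subst partial_eqI[OF has_derivative_diff]) (auto simp: partial_def)

lemma partial_mult:
  assumes "f differentiable (at x)" "g differentiable (at x)"
  shows "partial i (\<lambda>y. f y * g y) x = f x * partial i g x + partial i f x * g x"
  using assms unfolding frechet_derivative_works
  by (subst partial_eqI[OF has_derivative_mult]) (auto simp: partial_def)

lemma partial_sum:
  assumes "\<And>k. k \<in> K \<Longrightarrow> f k differentiable (at x)"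
  shows "partial i (\<lambda>y. \<Sum>k\<in>K. f k y) x = (\<Sum>k\<in>K. partial i (f k) x)"
proof -
  have "((\<lambda>y. \<Sum>k\<in>K. f k y) has_derivative (\<lambda>h. \<Sum>k\<in>K. frechet_derivative (f k) (at x) h)) (at x)"
    using assms frechet_derivative_works by (intro has_derivative_sum) auto
  from partial_eqI[OF this] show ?thesis
    by (simp add: partial_def)
qed

lemma partial_const: "partial i (\<lambda>y. a) x = 0"
  by (subst partial_eqI[OF has_derivative_const]) simp

lemma partial_component: "partial i (\<lambda>y. y $ j) x = (if i = j then 1 else 0)"
proof -
  have "((\<lambda>y. y $ j) has_derivative (\<lambda>y. y $ j)) (at x)"
    by (intro bounded_linear_imp_has_derivative bounded_linear_vec_nth)
  then show ?thesis
    by (simp add: partial_eqI axis_def)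
qed

lemma has_real_derivative_along_line:
  fixes g :: "real^'d::finite \<Rightarrow> real"
  assumes "g differentiable (at (x + s *\<^sub>R axis i 1))"
  shows "((\<lambda>s. g (x + s *\<^sub>R axis i 1)) has_real_derivative partial i g (x + s *\<^sub>R axis i 1)) (at s)"
proof -
  have "((\<lambda>s. x + s *\<^sub>R axis i 1) has_vector_derivative axis i (1::real)) (at s)"
    by (auto intro!: derivative_eq_intros)
  moreover have "(g has_derivative frechet_derivative g (at (x + s *\<^sub>R axis i 1))) (at (x + s *\<^sub>R axis i 1))"
    using assms by (simp add: frechet_derivative_works)
  ultimately have "((g \<circ> (\<lambda>s. x + s *\<^sub>R axis i 1)) has_vector_derivative partial i g (x + s *\<^sub>R axis i 1)) (at s)"
    unfolding partial_def
    by (rule vector_derivative_diff_chain_within[OF _ has_derivative_at_withinI])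
  then show ?thesis
    by (simp add: has_real_derivative_iff_has_vector_derivative o_def)
qed

text \<open>The mean value theorem is applied in direction \<open>i\<close> to the increment of \<open>g\<close> in direction \<open>k\<close>, then in
  direction \<open>k\<close> to \<open>\<partial>\<^sub>i g\<close>. The second difference is symmetric in \<open>i\<close> and \<open>k\<close> while the right-hand side
  is not, whence the symmetry of second derivatives.\<close>
lemma second_difference_eq_mixed_partial:
  fixes g :: "real^'d::finite \<Rightarrow> real"
  assumes "h > 0"
    and dom: "\<And>s t. 0 \<le> s \<Longrightarrow> s \<le> h \<Longrightarrow> 0 \<le> t \<Longrightarrow> t \<le> h \<Longrightarrow> x + s *\<^sub>R axis i 1 + t *\<^sub>R axis k 1 \<in> \<Omega>"
    and d1: "\<And>y. y \<in> \<Omega> \<Longrightarrow> g differentiable (at y)"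
    and d2: "\<And>y. y \<in> \<Omega> \<Longrightarrow> partial i g differentiable (at y)"
  obtains s t where "0 < s" "s < h" "0 < t" "t < h"
    "g (x + h *\<^sub>R axis i 1 + h *\<^sub>R axis k 1) - g (x + h *\<^sub>R axis i 1) - g (x + h *\<^sub>R axis k 1) + g x
       = h\<^sup>2 * partial k (partial i g) (x + s *\<^sub>R axis i 1 + t *\<^sub>R axis k 1)"
proof -
  let ?u = "axis i 1 :: real^'d" and ?v = "axis k 1 :: real^'d"
  have D: "((\<lambda>s. g (x + h *\<^sub>R ?v + s *\<^sub>R ?u) - g (x + s *\<^sub>R ?u)) has_real_derivative
      partial i g (x + h *\<^sub>R ?v + s *\<^sub>R ?u) - partial i g (x + s *\<^sub>R ?u)) (at s)"
    if "0 \<le> s" "s \<le> h" for s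
    using dom[of s h] dom[of s 0] that \<open>h > 0\<close>
    by (intro DERIV_diff has_real_derivative_along_line d1) (auto simp: algebra_simps)
  obtain s where s: "0 < s" "s < h" and
    eq1: "g (x + h *\<^sub>R ?v + h *\<^sub>R ?u) - g (x + h *\<^sub>R ?u) - (g (x + h *\<^sub>R ?v + 0 *\<^sub>R ?u) - g (x + 0 *\<^sub>R ?u)) =
       (h - 0) * (partial i g (x + h *\<^sub>R ?v + s *\<^sub>R ?u) - partial i g (x + s *\<^sub>R ?u))"
    using MVT2[OF \<open>h > 0\<close> D] by blast
  have D': "((\<lambda>t. partial i g (x + s *\<^sub>R ?u + t *\<^sub>R ?v)) has_real_derivative
      partial k (partial i g) (x + s *\<^sub>R ?u + t *\<^sub>R ?v)) (at t)"
    if "0 \<le> t" "t \<le> h" for t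
    using dom[of s t] that s
    by (intro has_real_derivative_along_line d2) auto
  obtain t where t: "0 < t" "t < h" and
    eq2: "partial i g (x + s *\<^sub>R ?u + h *\<^sub>R ?v) - partial i g (x + s *\<^sub>R ?u + 0 *\<^sub>R ?v) =
       (h - 0) * partial k (partial i g) (x + s *\<^sub>R ?u + t *\<^sub>R ?v)"
    using MVT2[OF \<open>h > 0\<close> D'] by blast
  have "g (x + h *\<^sub>R ?u + h *\<^sub>R ?v) - g (x + h *\<^sub>R ?u) - g (x + h *\<^sub>R ?v) + g x
       = h * (h * partial k (partial i g) (x + s *\<^sub>R ?u + t *\<^sub>R ?v))"
    using eq1 eq2 by (simp add: algebra_simps)
  then show ?thesis
    using that[OF s t] by (simp add: power2_eq_square mult.assoc)
qed

text \<open>If the two mixed derivatives differed at \<open>x\<close>, by continuity they would take no common value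
  at points close to \<open>x\<close>. But divided second differences over a small square are values of both.\<close>
lemma partial_commute:
  fixes g :: "real^'d::finite \<Rightarrow> real"
  assumes "open \<Omega>" "x \<in> \<Omega>" "smooth_on \<Omega> g"
  shows "partial k (partial i g) x = partial i (partial k g) x"
proof (rule ccontr)
  assume ne: "partial k (partial i g) x \<noteq> partial i (partial k g) x"
  have sm: "iter_partial js g differentiable (at y)" if "y \<in> \<Omega>" for js y
    using assms(3) that by (auto simp: smooth_on_def)
  have d1: "g differentiable (at y)" if "y \<in> \<Omega>" for y
    using sm[OF that, of "[]"] by simp
  have d2: "partial j g differentiable (at y)" if "y \<in> \<Omega>" for j y
    using sm[OF that, of "[j]"] by simp
  have cont: "isCont (partial j (partial l g)) x" for j l
    using sm[OF assms(2), of "[j, l]"] by (simp add: differentiable_imp_continuous_within)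
  define e where "e = \<bar>partial k (partial i g) x - partial i (partial k g) x\<bar> / 2"
  have "e > 0" using ne by (simp add: e_def)
  obtain d1' where d1': "d1' > 0" "\<And>y. dist y x < d1' \<Longrightarrow> dist (partial k (partial i g) y) (partial k (partial i g) x) < e"
    using cont[of k i] \<open>e > 0\<close> unfolding continuous_at_eps_delta by (metis dist_commute)
  obtain d2' where d2': "d2' > 0" "\<And>y. dist y x < d2' \<Longrightarrow> dist (partial i (partial k g) y) (partial i (partial k g) x) < e"
    using cont[of i k] \<open>e > 0\<close> unfolding continuous_at_eps_delta by (metis dist_commute)
  obtain r where r: "r > 0" "ball x r \<subseteq> \<Omega>"
    using assms(1,2) open_contains_ball by blast
  define h where "h = min r (min d1' d2') / 3"
  have "h > 0" using r d1' d2' by (simp add: h_def)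
  have close: "dist (x + s *\<^sub>R axis j 1 + t *\<^sub>R axis l 1) x < min r (min d1' d2')"
    if "0 \<le> s" "s \<le> h" "0 \<le> t" "t \<le> h" for s t j l
  proof -
    have "dist (x + s *\<^sub>R axis j 1 + t *\<^sub>R axis l 1) x \<le> norm (s *\<^sub>R axis j 1 :: real^'d) + norm (t *\<^sub>R axis l 1 :: real^'d)"
      by (simp add: dist_norm norm_triangle_ineq add.assoc del: norm_scaleR)
    also have "\<dots> \<le> h + h" using that by (simp add: norm_axis_1)
    also have "\<dots> < min r (min d1' d2')" using \<open>h > 0\<close> unfolding h_def by linarith
    finally show ?thesis .
  qed
  have dom: "x + s *\<^sub>R axis j 1 + t *\<^sub>R axis l 1 \<in> \<Omega>"
    if "0 \<le> s" "s \<le> h" "0 \<le> t" "t \<le> h" for s t j l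
    using close[OF that, of j l] r by (auto simp: dist_commute)
  obtain s t where st: "0 < s" "s < h" "0 < t" "t < h"
    "g (x + h *\<^sub>R axis i 1 + h *\<^sub>R axis k 1) - g (x + h *\<^sub>R axis i 1) - g (x + h *\<^sub>R axis k 1) + g x
       = h\<^sup>2 * partial k (partial i g) (x + s *\<^sub>R axis i 1 + t *\<^sub>R axis k 1)"
    using second_difference_eq_mixed_partial[OF \<open>h > 0\<close> dom d1 d2] by blast
  obtain s' t' where st': "0 < s'" "s' < h" "0 < t'" "t' < h"
    "g (x + h *\<^sub>R axis k 1 + h *\<^sub>R axis i 1) - g (x + h *\<^sub>R axis k 1) - g (x + h *\<^sub>R axis i 1) + g x
       = h\<^sup>2 * partial i (partial k g) (x + s' *\<^sub>R axis k 1 + t' *\<^sub>R axis i 1)"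
    using second_difference_eq_mixed_partial[OF \<open>h > 0\<close> dom d1 d2] by blast
  have swap: "x + h *\<^sub>R axis k 1 + h *\<^sub>R axis i 1 = x + h *\<^sub>R axis i 1 + h *\<^sub>R axis k 1"
    by simp
  have "h\<^sup>2 * partial k (partial i g) (x + s *\<^sub>R axis i 1 + t *\<^sub>R axis k 1)
      = h\<^sup>2 * partial i (partial k g) (x + s' *\<^sub>R axis k 1 + t' *\<^sub>R axis i 1)"
    using st(5) st'(5) unfolding swap by linarith
  then have "partial k (partial i g) (x + s *\<^sub>R axis i 1 + t *\<^sub>R axis k 1)
      = partial i (partial k g) (x + s' *\<^sub>R axis k 1 + t' *\<^sub>R axis i 1)"
    using \<open>h > 0\<close> by simp
  moreover have "dist (partial k (partial i g) (x + s *\<^sub>R axis i 1 + t *\<^sub>R axis k 1)) (partial k (partial i g) x) < e"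
    using close[of s t i k] st by (intro d1') auto
  moreover have "dist (partial i (partial k g) (x + s' *\<^sub>R axis k 1 + t' *\<^sub>R axis i 1)) (partial i (partial k g) x) < e"
    using close[of s' t' k i] st' by (intro d2') auto
  ultimately have "dist (partial k (partial i g) x) (partial i (partial k g) x) < 2 * e"
    using dist_triangle_half_r[of "partial k (partial i g) (x + s *\<^sub>R axis i 1 + t *\<^sub>R axis k 1)"
        "partial k (partial i g) x" "2 * e" "partial i (partial k g) x"] by simp
  then show False
    by (simp add: e_def dist_real_def)
qed

lemma outer_quadratic_form: "u \<bullet> (outer v v *v u) = (u \<bullet> v)\<^sup>2"
proof -
  have "outer v v *v u = (u \<bullet> v) *\<^sub>R v"
    by (simp add: vec_eq_iff outer_def matrix_vector_mult_def inner_vec_def sum_distrib_left mult_ac)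
  then show ?thesis by (simp add: power2_eq_square)
qed

section \<open>The algebra of smooth functions of polynomial growth\<close>

definition poly_bounded :: "'a::real_normed_vector set \<Rightarrow> ('a \<Rightarrow> real) \<Rightarrow> bool" where
  "poly_bounded \<Omega> f \<longleftrightarrow> (\<exists>C k. \<forall>x\<in>\<Omega>. \<bar>f x\<bar> \<le> C * (1 + norm x ^ k))"

text \<open>Powers of \<open>1 + norm x\<close> are monotone in the exponent and multiply without cross terms, so
  this form makes closure under sums and products immediate.\<close>
lemma poly_bounded_iff:
  "poly_bounded \<Omega> f \<longleftrightarrow> (\<exists>C k. 0 \<le> C \<and> (\<forall>x\<in>\<Omega>. \<bar>f x\<bar> \<le> C * (1 + norm x) ^ k))"
proof
  assume "poly_bounded \<Omega> f"
  then obtain C k where C: "\<And>x. x \<in> \<Omega> \<Longrightarrow> \<bar>f x\<bar> \<le> C * (1 + norm x ^ k)"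
    unfolding poly_bounded_def by blast
  have "\<bar>f x\<bar> \<le> (2 * \<bar>C\<bar>) * (1 + norm x) ^ k" if "x \<in> \<Omega>" for x
  proof -
    have "1 + norm x ^ k \<le> (1 + norm x) ^ k + (1 + norm x) ^ k"
      by (intro add_mono power_mono one_le_power) auto
    then have "C * (1 + norm x ^ k) \<le> \<bar>C\<bar> * (2 * (1 + norm x) ^ k)"
      by (intro mult_mono) auto
    then show ?thesis using C[OF that] by simp
  qed
  then show "\<exists>C k. 0 \<le> C \<and> (\<forall>x\<in>\<Omega>. \<bar>f x\<bar> \<le> C * (1 + norm x) ^ k)"
    by (intro exI[of _ "2 * \<bar>C\<bar>"] exI[of _ k]) auto
next
  assume "\<exists>C k. 0 \<le> C \<and> (\<forall>x\<in>\<Omega>. \<bar>f x\<bar> \<le> C * (1 + norm x) ^ k)"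
  then obtain C k where C: "0 \<le> C" "\<And>x. x \<in> \<Omega> \<Longrightarrow> \<bar>f x\<bar> \<le> C * (1 + norm x) ^ k"
    by blast
  have "\<bar>f x\<bar> \<le> (C * 2 ^ k) * (1 + norm x ^ k)" if "x \<in> \<Omega>" for x
  proof -
    have "(1 + norm x) ^ k \<le> (2 * max 1 (norm x)) ^ k"
      by (intro power_mono) auto
    also have "\<dots> \<le> 2 ^ k * (1 + norm x ^ k)"
      by (simp add: power_mult_distrib max_def)
    finally have "C * (1 + norm x) ^ k \<le> C * (2 ^ k * (1 + norm x ^ k))"
      using C(1) by (intro mult_left_mono)
    then show ?thesis using C(2)[OF that] by (simp add: mult.assoc)
  qed
  then show "poly_bounded \<Omega> f" unfolding poly_bounded_def by blast
qed

lemma poly_bounded_mult: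
  assumes "poly_bounded \<Omega> f" "poly_bounded \<Omega> g"
  shows "poly_bounded \<Omega> (\<lambda>x. f x * g x)"
proof -
  obtain C k where C: "0 \<le> C" "\<And>x. x \<in> \<Omega> \<Longrightarrow> \<bar>f x\<bar> \<le> C * (1 + norm x) ^ k"
    using assms(1) unfolding poly_bounded_iff by blast
  obtain D l where D: "0 \<le> D" "\<And>x. x \<in> \<Omega> \<Longrightarrow> \<bar>g x\<bar> \<le> D * (1 + norm x) ^ l"
    using assms(2) unfolding poly_bounded_iff by blast
  have "\<bar>f x * g x\<bar> \<le> (C * D) * (1 + norm x) ^ (k + l)" if "x \<in> \<Omega>" for x
    using mult_mono[OF C(2)[OF that] D(2)[OF that]] C(1)
    by (simp add: abs_mult power_add algebra_simps)
  then show ?thesis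
    unfolding poly_bounded_iff using C(1) D(1) by (intro exI[of _ "C * D"] exI[of _ "k + l"]) auto
qed

lemma poly_bounded_add:
  assumes "poly_bounded \<Omega> f" "poly_bounded \<Omega> g"
  shows "poly_bounded \<Omega> (\<lambda>x. f x + g x)"
proof -
  obtain C k where C: "0 \<le> C" "\<And>x. x \<in> \<Omega> \<Longrightarrow> \<bar>f x\<bar> \<le> C * (1 + norm x) ^ k"
    using assms(1) unfolding poly_bounded_iff by blast
  obtain D l where D: "0 \<le> D" "\<And>x. x \<in> \<Omega> \<Longrightarrow> \<bar>g x\<bar> \<le> D * (1 + norm x) ^ l"
    using assms(2) unfolding poly_bounded_iff by blast
  have "\<bar>f x + g x\<bar> \<le> (C + D) * (1 + norm x) ^ (k + l)" if "x \<in> \<Omega>" for x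
  proof -
    have "C * (1 + norm x) ^ k \<le> C * (1 + norm x) ^ (k + l)"
      "D * (1 + norm x) ^ l \<le> D * (1 + norm x) ^ (k + l)"
      using C(1) D(1) by (auto intro!: mult_left_mono power_increasing)
    then show ?thesis
      using C(2)[OF that] D(2)[OF that] by (simp add: distrib_right)
  qed
  then show ?thesis
    unfolding poly_bounded_iff using C(1) D(1) by (intro exI[of _ "C + D"] exI[of _ "k + l"]) auto
qed

lemma poly_smooth_iff:
  "f \<in> poly_smooth \<Omega> \<longleftrightarrow>
     (\<forall>js. (\<forall>x\<in>\<Omega>. iter_partial js f differentiable (at x)) \<and> poly_bounded \<Omega> (iter_partial js f))"
  by (auto simp: poly_smooth_def smooth_on_def poly_bounded_def)

lemma poly_smooth_differentiable:
  assumes "f \<in> poly_smooth \<Omega>" "x \<in> \<Omega>"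
  shows "f differentiable (at x)"
  using assms by (force simp: poly_smooth_iff dest: spec[of _ "[]"])

lemma poly_smooth_poly_bounded:
  assumes "f \<in> poly_smooth \<Omega>"
  shows "poly_bounded \<Omega> f"
  using assms by (force simp: poly_smooth_iff dest: spec[of _ "[]"])

lemma poly_smooth_partial:
  assumes "f \<in> poly_smooth \<Omega>"
  shows "partial i f \<in> poly_smooth \<Omega>"
  using assms unfolding poly_smooth_iff iter_partial_append[symmetric] by blast

text \<open>The class is the largest set of differentiable functions of polynomial growth that is
  closed, up to equality on \<open>\<Omega>\<close>, under partial derivatives. With this principle closure properties
  need no Leibniz formula for higher derivatives.\<close>
lemma poly_smooth_coinduct:
  assumes "open \<Omega>" "f \<in> F"
    and diff: "\<And>g x. g \<in> F \<Longrightarrow> x \<in> \<Omega> \<Longrightarrow> g differentiable (at x)"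
    and bound: "\<And>g. g \<in> F \<Longrightarrow> poly_bounded \<Omega> g"
    and step: "\<And>g i. g \<in> F \<Longrightarrow> \<exists>g'\<in>F. \<forall>x\<in>\<Omega>. partial i g x = g' x"
  shows "f \<in> poly_smooth \<Omega>"
proof -
  have *: "\<exists>g'\<in>F. \<forall>x\<in>\<Omega>. iter_partial js f x = g' x" for js
  proof (induction js)
    case Nil
    then show ?case using assms(2) by auto
  next
    case (Cons i js)
    then obtain g where g: "g \<in> F" "\<And>x. x \<in> \<Omega> \<Longrightarrow> iter_partial js f x = g x"
      by blast
    have "partial i (iter_partial js f) x = partial i g x" if "x \<in> \<Omega>" for x
      using partial_cong_open[OF assms(1) that g(2)] .
    then show ?case using step[OF g(1), of i] by auto
  qed
  show ?thesis
    unfolding poly_smooth_iff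
  proof (intro allI conjI ballI)
    fix js
    obtain g where g: "g \<in> F" "\<And>x. x \<in> \<Omega> \<Longrightarrow> iter_partial js f x = g x"
      using *[of js] by blast
    show "iter_partial js f differentiable (at x)" if "x \<in> \<Omega>" for x
      using differentiable_cong_open[OF assms(1) that g(2)] diff[OF g(1) that] by simp
    show "poly_bounded \<Omega> (iter_partial js f)"
      using bound[OF g(1)] g(2) by (simp add: poly_bounded_def)
  qed
qed

text \<open>The coordinate functions are included because they serve as test functions in
  \<open>jump_gradient_factor_nonneg\<close>.\<close>
inductive_set poly_smooth_alg :: "(real^'d::finite) set \<Rightarrow> (real^'d \<Rightarrow> real) set" for \<Omega> where
  base: "f \<in> poly_smooth \<Omega> \<Longrightarrow> f \<in> poly_smooth_alg \<Omega>"
| const: "(\<lambda>x. a) \<in> poly_smooth_alg \<Omega>"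
| component: "(\<lambda>x. x $ j) \<in> poly_smooth_alg \<Omega>"
| add: "f \<in> poly_smooth_alg \<Omega> \<Longrightarrow> g \<in> poly_smooth_alg \<Omega> \<Longrightarrow> (\<lambda>x. f x + g x) \<in> poly_smooth_alg \<Omega>"
| mult: "f \<in> poly_smooth_alg \<Omega> \<Longrightarrow> g \<in> poly_smooth_alg \<Omega> \<Longrightarrow> (\<lambda>x. f x * g x) \<in> poly_smooth_alg \<Omega>"

lemma poly_smooth_alg_differentiable:
  assumes "f \<in> poly_smooth_alg \<Omega>" "x \<in> \<Omega>"
  shows "f differentiable (at x)"
  using assms
proof induction
  case (component j)
  show ?case
    using bounded_linear_imp_differentiable[OF bounded_linear_vec_nth] .
qed (auto intro: poly_smooth_differentiable differentiable_add differentiable_mult)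

lemma poly_smooth_alg_poly_bounded:
  assumes "f \<in> poly_smooth_alg \<Omega>"
  shows "poly_bounded \<Omega> f"
  using assms
proof induction
  case (const a)
  show ?case unfolding poly_bounded_def by (intro exI[of _ "\<bar>a\<bar>"] exI[of _ 0]) auto
next
  case (component j)
  have "\<bar>x $ j\<bar> \<le> 1 * (1 + norm x ^ 1)" for x :: "real^'a"
    using component_le_norm_cart[of x j] by simp
  then show ?case unfolding poly_bounded_def by blast
qed (auto intro: poly_smooth_poly_bounded poly_bounded_add poly_bounded_mult)

lemma poly_smooth_alg_partial:
  assumes "f \<in> poly_smooth_alg \<Omega>"
  shows "\<exists>g\<in>poly_smooth_alg \<Omega>. \<forall>x\<in>\<Omega>. partial i f x = g x"
  using assms
proof induction
  case (base f)
  then show ?case using poly_smooth_partial poly_smooth_alg.base by blast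
next
  case (const a)
  show ?case
    by (rule bexI[of _ "\<lambda>x. 0"]) (auto simp: partial_const poly_smooth_alg.const)
next
  case (component j)
  show ?case
    by (rule bexI[of _ "\<lambda>x. if i = j then 1 else 0"]) (auto simp: partial_component poly_smooth_alg.const)
next
  case (add f g)
  then obtain f' g' where "f' \<in> poly_smooth_alg \<Omega>" "g' \<in> poly_smooth_alg \<Omega>"
    "\<forall>x\<in>\<Omega>. partial i f x = f' x" "\<forall>x\<in>\<Omega>. partial i g x = g' x" by blast
  then show ?case
    using add.hyps
    by (intro bexI[of _ "\<lambda>x. f' x + g' x"])
       (auto simp: partial_add poly_smooth_alg_differentiable poly_smooth_alg.add)
next
  case (mult f g)
  then obtain f' g' where "f' \<in> poly_smooth_alg \<Omega>" "g' \<in> poly_smooth_alg \<Omega>"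
    "\<forall>x\<in>\<Omega>. partial i f x = f' x" "\<forall>x\<in>\<Omega>. partial i g x = g' x" by blast
  then show ?case
    using mult.hyps
    by (intro bexI[of _ "\<lambda>x. f x * g' x + f' x * g x"])
       (auto simp: partial_mult poly_smooth_alg_differentiable poly_smooth_alg.add poly_smooth_alg.mult)
qed

lemma poly_smooth_alg_eq:
  assumes "open \<Omega>"
  shows "poly_smooth_alg \<Omega> = poly_smooth \<Omega>"
  using poly_smooth_coinduct[OF assms _ poly_smooth_alg_differentiable
      poly_smooth_alg_poly_bounded poly_smooth_alg_partial]
  by (auto intro: poly_smooth_alg.base)

lemma poly_smooth_add:
  assumes "open \<Omega>" "f \<in> poly_smooth \<Omega>" "g \<in> poly_smooth \<Omega>"
  shows "(\<lambda>x. f x + g x) \<in> poly_smooth \<Omega>"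
  using poly_smooth_alg.add[of f \<Omega> g] assms by (simp add: poly_smooth_alg_eq)

lemma poly_smooth_mult:
  assumes "open \<Omega>" "f \<in> poly_smooth \<Omega>" "g \<in> poly_smooth \<Omega>"
  shows "(\<lambda>x. f x * g x) \<in> poly_smooth \<Omega>"
  using poly_smooth_alg.mult[of f \<Omega> g] assms by (simp add: poly_smooth_alg_eq)

lemma poly_smooth_const:
  assumes "open \<Omega>"
  shows "(\<lambda>x. a) \<in> poly_smooth \<Omega>"
  using poly_smooth_alg.const[of a \<Omega>] assms by (simp add: poly_smooth_alg_eq)

lemma poly_smooth_component:
  assumes "open \<Omega>"
  shows "(\<lambda>x. x $ j) \<in> poly_smooth \<Omega>"
  using poly_smooth_alg.component[of j \<Omega>] assms by (simp add: poly_smooth_alg_eq)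

lemma poly_smooth_sum:
  assumes "open \<Omega>" "\<And>k. k \<in> K \<Longrightarrow> f k \<in> poly_smooth \<Omega>"
  shows "(\<lambda>x. \<Sum>k\<in>K. f k x) \<in> poly_smooth \<Omega>"
  using assms(2)
  by (induction K rule: infinite_finite_induct)
     (auto intro: poly_smooth_const poly_smooth_add assms(1))

lemma poly_smooth_square:
  assumes "open \<Omega>" "f \<in> poly_smooth \<Omega>"
  shows "(\<lambda>x. (f x)\<^sup>2) \<in> poly_smooth \<Omega>"
  using poly_smooth_mult[OF assms assms(2)] by (simp add: power2_eq_square)

lemma poly_smooth_inner_grad:
  assumes "open \<Omega>" "f \<in> poly_smooth \<Omega>" "g \<in> poly_smooth \<Omega>"
  shows "(\<lambda>x. grad f x \<bullet> grad g x) \<in> poly_smooth \<Omega>"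
  unfolding inner_vec_def grad_def using assms
  by (auto intro!: poly_smooth_sum poly_smooth_mult poly_smooth_partial)

lemma poly_smooth_norm_grad:
  assumes "open \<Omega>" "f \<in> poly_smooth \<Omega>"
  shows "(\<lambda>x. (norm (grad f x))\<^sup>2) \<in> poly_smooth \<Omega>"
  using poly_smooth_inner_grad[OF assms assms(2)] by (simp add: power2_norm_eq_inner)

lemma continuous_on_poly_smooth:
  assumes "f \<in> poly_smooth \<Omega>"
  shows "continuous_on \<Omega> f"
  using poly_smooth_differentiable[OF assms]
  by (auto intro!: continuous_at_imp_continuous_on differentiable_imp_continuous_within)

section \<open>Invariant laws\<close>

text \<open>Invariance alone makes \<open>K\<close> a measurable kernel. By convention a function that is not integrable
  has integral \<open>0\<close>, so the hypothesis forces \<open>x \<mapsto> K x B\<close> to be integrable if \<open>B\<close> is not a null set.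
  If it is, then the complement of \<open>B\<close> is not a null set.\<close>

lemma invariant_kernel_measurable:
  assumes "prob_space \<mu>"
    and K: "\<And>x. x \<in> space \<mu> \<Longrightarrow> prob_space (K x)" "\<And>x. x \<in> space \<mu> \<Longrightarrow> sets (K x) = sets \<mu>"
    and inv: "\<And>B. B \<in> sets \<mu> \<Longrightarrow> (\<integral>x. measure (K x) B \<partial>\<mu>) = measure \<mu> B"
  shows "K \<in> \<mu> \<rightarrow>\<^sub>M subprob_algebra \<mu>"
    and "\<And>B. B \<in> sets \<mu> \<Longrightarrow> integrable \<mu> (\<lambda>x. measure (K x) B)"
proof -
  interpret \<mu>: prob_space \<mu> by fact
  have pos: "integrable \<mu> (\<lambda>x. measure (K x) B)" if "B \<in> sets \<mu>" "measure \<mu> B \<noteq> 0" for B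
    using inv[OF that(1)] that(2) not_integrable_integral_eq by metis
  show int: "integrable \<mu> (\<lambda>x. measure (K x) B)" if B: "B \<in> sets \<mu>" for B
  proof (cases "measure \<mu> B = 0")
    case True
    then have "measure \<mu> (space \<mu> - B) \<noteq> 0"
      using \<mu>.prob_compl[OF B] by simp
    then have "integrable \<mu> (\<lambda>x. measure (K x) (space \<mu> - B))"
      using pos B by auto
    then have "integrable \<mu> (\<lambda>x. 1 - measure (K x) (space \<mu> - B))"
      by simp
    moreover have "1 - measure (K x) (space \<mu> - B) = measure (K x) B" if x: "x \<in> space \<mu>" for x
    proof -
      interpret Kx: prob_space "K x" using K(1)[OF x] .
      have "space (K x) = space \<mu>" "B \<in> sets (K x)"
        using sets_eq_imp_space_eq[OF K(2)[OF x]] B K(2)[OF x] by auto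
      then show ?thesis using Kx.prob_compl[of B] by simp
    qed
    ultimately show ?thesis
      using Bochner_Integration.integrable_cong[of \<mu> \<mu> "\<lambda>x. 1 - measure (K x) (space \<mu> - B)"] by simp
  qed (use pos B in auto)
  show "K \<in> \<mu> \<rightarrow>\<^sub>M subprob_algebra \<mu>"
  proof (rule measurable_subprob_algebra)
    fix B assume B: "B \<in> sets \<mu>"
    have "(\<lambda>x. ennreal (measure (K x) B)) \<in> borel_measurable \<mu>"
      using int[OF B] by (intro measurable_compose[OF _ measurable_ennreal]) auto
    moreover have "ennreal (measure (K x) B) = emeasure (K x) B" if "x \<in> space \<mu>" for x
      using K(1)[OF that] by (simp add: finite_measure.emeasure_eq_measure prob_space.finite_measure)
    ultimately show "(\<lambda>x. emeasure (K x) B) \<in> borel_measurable \<mu>"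
      by (subst measurable_cong[of _ _ "\<lambda>x. ennreal (measure (K x) B)"]) auto
  qed (use K prob_space_imp_subprob_space in auto)
qed

text \<open>Invariance on sets says that \<open>\<mu>\<close> bound with \<open>K\<close> is \<open>\<mu>\<close> itself.\<close>
lemma invariant_kernel_nn_integral:
  assumes "prob_space \<mu>"
    and K: "\<And>x. x \<in> space \<mu> \<Longrightarrow> prob_space (K x)" "\<And>x. x \<in> space \<mu> \<Longrightarrow> sets (K x) = sets \<mu>"
    and inv: "\<And>B. B \<in> sets \<mu> \<Longrightarrow> (\<integral>x. measure (K x) B \<partial>\<mu>) = measure \<mu> B"
    and g: "g \<in> borel_measurable \<mu>"
  shows "(\<integral>\<^sup>+x. \<integral>\<^sup>+y. g y \<partial>K x \<partial>\<mu>) = (\<integral>\<^sup>+x. g x \<partial>\<mu>)"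
proof -
  interpret \<mu>: prob_space \<mu> by fact
  note m = invariant_kernel_measurable[OF assms(1) K inv]
  have "\<mu> \<bind> K = \<mu>"
  proof (rule measure_eqI)
    show sets: "sets (\<mu> \<bind> K) = sets \<mu>"
      using \<mu>.not_empty K(2) by (intro sets_bind) auto
    fix B assume "B \<in> sets (\<mu> \<bind> K)"
    then have B: "B \<in> sets \<mu>" using sets by simp
    have "emeasure (\<mu> \<bind> K) B = (\<integral>\<^sup>+x. emeasure (K x) B \<partial>\<mu>)"
      using emeasure_bind[OF \<mu>.not_empty m(1) B] .
    also have "\<dots> = (\<integral>\<^sup>+x. ennreal (measure (K x) B) \<partial>\<mu>)"
      using K(1)
      by (intro nn_integral_cong)
         (simp add: finite_measure.emeasure_eq_measure prob_space.finite_measure)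
    also have "\<dots> = ennreal (\<integral>x. measure (K x) B \<partial>\<mu>)"
      by (intro nn_integral_eq_integral m(2) B) auto
    finally show "emeasure (\<mu> \<bind> K) B = emeasure \<mu> B"
      by (simp add: inv[OF B] \<mu>.emeasure_eq_measure)
  qed
  then show ?thesis
    using nn_integral_bind[OF g m(1)] by simp
qed

lemma invariant_kernel_integral:
  fixes g :: "'a \<Rightarrow> real"
  assumes "prob_space \<mu>"
    and K: "\<And>x. x \<in> space \<mu> \<Longrightarrow> prob_space (K x)" "\<And>x. x \<in> space \<mu> \<Longrightarrow> sets (K x) = sets \<mu>"
    and inv: "\<And>B. B \<in> sets \<mu> \<Longrightarrow> (\<integral>x. measure (K x) B \<partial>\<mu>) = measure \<mu> B"
    and g: "integrable \<mu> g" "\<And>x. x \<in> space \<mu> \<Longrightarrow> integrable (K x) g"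
  shows "(\<integral>x. (\<integral>y. g y \<partial>K x) \<partial>\<mu>) = (\<integral>x. g x \<partial>\<mu>)"
proof -
  note m = invariant_kernel_measurable[OF assms(1) K inv]
  \<comment> \<open>applied below to the positive and the negative part of \<open>g\<close>, as \<open>ennreal\<close> truncates at \<open>0\<close>\<close>
  have part: "integrable \<mu> (\<lambda>x. enn2real (\<integral>\<^sup>+y. ennreal (h y) \<partial>K x)) \<and>
      (\<integral>x. enn2real (\<integral>\<^sup>+y. ennreal (h y) \<partial>K x) \<partial>\<mu>) = enn2real (\<integral>\<^sup>+x. ennreal (h x) \<partial>\<mu>)"
    if h: "integrable \<mu> h" "\<And>x. x \<in> space \<mu> \<Longrightarrow> integrable (K x) h" for h :: "'a \<Rightarrow> real"
  proof -
    have hm: "(\<lambda>x. ennreal (h x)) \<in> borel_measurable \<mu>"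
      using h(1) by (intro measurable_compose[OF _ measurable_ennreal]) auto
    have meas: "(\<lambda>x. \<integral>\<^sup>+y. ennreal (h y) \<partial>K x) \<in> borel_measurable \<mu>"
      using measurable_compose[OF m(1) nn_integral_measurable_subprob_algebra[OF hm]] .
    have fin: "(\<integral>\<^sup>+y. ennreal (h y) \<partial>K x) \<noteq> \<infinity>" if "x \<in> space \<mu>" for x
      using h(2)[OF that] unfolding real_integrable_def by blast
    have "(\<integral>\<^sup>+x. ennreal (enn2real (\<integral>\<^sup>+y. ennreal (h y) \<partial>K x)) \<partial>\<mu>) = (\<integral>\<^sup>+x. \<integral>\<^sup>+y. ennreal (h y) \<partial>K x \<partial>\<mu>)"
      using fin by (intro nn_integral_cong) (simp add: top.not_eq_extremum)
    also have "\<dots> = (\<integral>\<^sup>+x. ennreal (h x) \<partial>\<mu>)"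
      by (rule invariant_kernel_nn_integral[OF assms(1) K inv hm])
    finally have eq: "(\<integral>\<^sup>+x. ennreal (enn2real (\<integral>\<^sup>+y. ennreal (h y) \<partial>K x)) \<partial>\<mu>) = (\<integral>\<^sup>+x. ennreal (h x) \<partial>\<mu>)" .
    have fin': "(\<integral>\<^sup>+x. ennreal (h x) \<partial>\<mu>) \<noteq> \<infinity>"
      using h(1) unfolding real_integrable_def by blast
    have "integrable \<mu> (\<lambda>x. enn2real (\<integral>\<^sup>+y. ennreal (h y) \<partial>K x))"
      using meas fin' eq by (intro integrableI_nonneg) (auto simp: top.not_eq_extremum)
    moreover have "(\<integral>x. enn2real (\<integral>\<^sup>+y. ennreal (h y) \<partial>K x) \<partial>\<mu>) = enn2real (\<integral>\<^sup>+x. ennreal (h x) \<partial>\<mu>)"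
      using meas by (subst integral_eq_nn_integral) (auto simp: eq)
    ultimately show ?thesis by simp
  qed
  have "(\<integral>x. (\<integral>y. g y \<partial>K x) \<partial>\<mu>) =
      (\<integral>x. enn2real (\<integral>\<^sup>+y. ennreal (g y) \<partial>K x) - enn2real (\<integral>\<^sup>+y. ennreal (- g y) \<partial>K x) \<partial>\<mu>)"
    using g(2) by (intro Bochner_Integration.integral_cong real_lebesgue_integral_def refl)
  also have "\<dots> = enn2real (\<integral>\<^sup>+x. ennreal (g x) \<partial>\<mu>) - enn2real (\<integral>\<^sup>+x. ennreal (- g x) \<partial>\<mu>)"
    using part[of g] part[of "\<lambda>x. - g x"] g by (subst Bochner_Integration.integral_diff) auto
  also have "\<dots> = (\<integral>x. g x \<partial>\<mu>)"
    using g(1) by (rule real_lebesgue_integral_def[symmetric])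
  finally show ?thesis .
qed

section \<open>Exponential decay from a differential inequality\<close>

lemma at_within_Ici_neq_bot:
  fixes t :: real
  assumes "t \<ge> 0"
  shows "at t within {0..} \<noteq> bot"
proof -
  have "at_right t \<le> at t within {0..}"
    using assms by (intro at_le) auto
  then show ?thesis
    using trivial_limit_at_right_real[of t] by (metis bot.extremum_uniqueI)
qed

text \<open>The hypotheses make \<open>exp (\<kappa> t) H t\<close> nonincreasing.\<close>
lemma exp_decay_of_deriv_le:
  fixes H :: "real \<Rightarrow> real"
  assumes deriv: "\<And>t. t \<ge> 0 \<Longrightarrow> (H has_real_derivative D t) (at t within {0..})"
    and le: "\<And>t. t \<ge> 0 \<Longrightarrow> D t \<le> - \<kappa> * H t"
    and "t \<ge> 0"
  shows "H t \<le> H 0 * exp (- \<kappa> * t)"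
proof -
  let ?G = "\<lambda>s. exp (\<kappa> * s) * H s"
  have G: "(?G has_real_derivative exp (\<kappa> * s) * (D s + \<kappa> * H s)) (at s within {0..})" if "s \<ge> 0" for s
    using deriv[OF that] by (auto intro!: derivative_eq_intros simp: algebra_simps)
  have "?G 0 \<ge> ?G t"
  proof (rule DERIV_nonpos_imp_decreasing_open[OF \<open>t \<ge> 0\<close>])
    fix s assume s: "0 < s" "s < t"
    have "at s within {0..} = at s"
      using s by (intro at_within_interior) (simp add: interior_Ici[of "-1"])
    then have "(?G has_real_derivative exp (\<kappa> * s) * (D s + \<kappa> * H s)) (at s)"
      using G[of s] s by simp
    moreover have "exp (\<kappa> * s) * (D s + \<kappa> * H s) \<le> 0"
      using le[of s] s by (intro mult_nonneg_nonpos) auto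
    ultimately show "\<exists>y. (?G has_real_derivative y) (at s) \<and> y \<le> 0" by blast
  next
    have "continuous_on {0..} ?G"
      unfolding continuous_on_eq_continuous_within by (auto intro!: DERIV_continuous[OF G])
    then show "continuous_on {0..t} ?G"
      by (rule continuous_on_subset) auto
  qed
  then have "exp (\<kappa> * t) * H t * exp (- \<kappa> * t) \<le> H 0 * exp (- \<kappa> * t)"
    by (intro mult_right_mono) auto
  then show ?thesis
    by (simp add: exp_minus field_simps)
qed

section \<open>The generator and the invariant law\<close>

context pdmp_setting
begin

abbreviation "\<A> \<equiv> poly_smooth \<Omega>"
abbreviation "L \<equiv> generator b lam Q"
abbreviation "P \<equiv> transition_op Pr X"

lemmas square_closed = poly_smooth_square[OF open_domain]
lemmas norm_grad_closed = poly_smooth_norm_grad[OF open_domain]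

lemma prob_space_mu: "prob_space \<mu>"
  using invariant by (simp add: invariant_law_def)

lemma sets_mu: "sets \<mu> = sets (restrict_space borel \<Omega>)"
  using invariant by (simp add: invariant_law_def)

lemma space_mu: "space \<mu> = \<Omega>"
  using sets_eq_imp_space_eq[OF sets_mu] by (simp add: space_restrict_space)

lemma borel_measurable_mu:
  assumes "f \<in> \<A>"
  shows "f \<in> borel_measurable \<mu>"
  using borel_measurable_continuous_on_restrict[OF continuous_on_poly_smooth[OF assms]]
    measurable_cong_sets[OF sets_mu refl] by blast

lemma integrable_mu:
  assumes "f \<in> \<A>"
  shows "integrable \<mu> f"
proof -
  interpret \<mu>: prob_space \<mu> by (rule prob_space_mu)
  obtain C k where C: "\<And>x. x \<in> \<Omega> \<Longrightarrow> \<bar>f x\<bar> \<le> C * (1 + norm x ^ k)"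
    using poly_smooth_poly_bounded[OF assms] unfolding poly_bounded_def by blast
  show ?thesis
  proof (rule Bochner_Integration.integrable_bound)
    show "integrable \<mu> (\<lambda>x. C * (1 + norm x ^ k))"
      using moments by simp
    show "AE x in \<mu>. norm (f x) \<le> norm (C * (1 + norm x ^ k))"
      using C by (intro AE_I2) (fastforce simp: space_mu)
  qed (rule borel_measurable_mu[OF assms])
qed

text \<open>The laws of \<open>X t\<close> under \<open>Pr x\<close> form a kernel that preserves \<open>\<mu>\<close>.\<close>
lemma integral_transition:
  assumes "f \<in> \<A>" "t \<ge> 0"
  shows "(\<integral>x. P t f x \<partial>\<mu>) = (\<integral>x. f x \<partial>\<mu>)"
proof -
  define K where "K x = distr (Pr x) \<mu> (X t)" for x
  have X: "prob_space (Pr x)" "X t \<in> Pr x \<rightarrow>\<^sub>M \<mu>" if "x \<in> \<Omega>" for x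
    using process[OF that] assms(2) measurable_cong_sets[OF refl sets_mu, of "Pr x"]
    by (auto simp: is_pdmp_def)
  have K1: "prob_space (K x)" if "x \<in> space \<mu>" for x
    unfolding K_def using X that space_mu by (intro prob_space.prob_space_distr) auto
  have K2: "sets (K x) = sets \<mu>" if "x \<in> space \<mu>" for x
    by (simp add: K_def)
  have op: "P t g x = (\<integral>y. g y \<partial>K x)" if "x \<in> \<Omega>" "g \<in> borel_measurable \<mu>" for g x
    unfolding transition_op_def K_def using X[OF that(1)] that(2) by (subst integral_distr) auto
  have inv: "(\<integral>x. measure (K x) B \<partial>\<mu>) = measure \<mu> B" if "B \<in> sets \<mu>" for B
  proof -
    have "(\<integral>x. measure (K x) B \<partial>\<mu>) = (\<integral>x. P t (indicat_real B) x \<partial>\<mu>)"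
    proof (rule Bochner_Integration.integral_cong[OF refl])
      fix x assume x: "x \<in> space \<mu>"
      have "(\<integral>y. indicat_real B y \<partial>K x) = measure (K x) (B \<inter> space (K x))"
        by simp
      also have "B \<inter> space (K x) = B"
        using sets.sets_into_space[OF that] by (auto simp: K_def)
      finally show "measure (K x) B = P t (indicat_real B) x"
        using op[of x "indicat_real B"] x that by (simp add: space_mu)
    qed
    then show ?thesis
      using invariant that assms(2) by (simp add: invariant_law_def)
  qed
  have "integrable (K x) f" if "x \<in> space \<mu>" for x
    unfolding K_def using X P_defined[OF assms(1) _ assms(2)] that borel_measurable_mu[OF assms(1)]
    by (subst integrable_distr_eq) (auto simp: space_mu)
  then have "(\<integral>x. (\<integral>y. f y \<partial>K x) \<partial>\<mu>) = (\<integral>x. f x \<partial>\<mu>)"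
    by (intro invariant_kernel_integral[OF prob_space_mu K1 K2 inv integrable_mu[OF assms(1)]])
  moreover have "(\<integral>x. P t f x \<partial>\<mu>) = (\<integral>x. (\<integral>y. f y \<partial>K x) \<partial>\<mu>)"
    using op borel_measurable_mu[OF assms(1)] by (intro Bochner_Integration.integral_cong) (auto simp: space_mu)
  ultimately show ?thesis by simp
qed

lemma has_derivative_under_integral:
  assumes "diff_under_integral \<mu> F" "t \<ge> 0"
    and "\<And>x. x \<in> \<Omega> \<Longrightarrow> ((\<lambda>s. F s x) has_real_derivative F' x) (at t within {0..})"
  shows "((\<lambda>s. \<integral>x. F s x \<partial>\<mu>) has_real_derivative (\<integral>x. F' x \<partial>\<mu>)) (at t within {0..})"
proof -
  have "vector_derivative (\<lambda>s. F s x) (at t within {0..}) = F' x" if "x \<in> \<Omega>" for x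
    using assms(3)[OF that] at_within_Ici_neq_bot[OF assms(2)]
    by (intro vector_derivative_within) (auto simp: has_real_derivative_iff_has_vector_derivative)
  then have "(\<integral>x. vector_derivative (\<lambda>s. F s x) (at t within {0..}) \<partial>\<mu>) = (\<integral>x. F' x \<partial>\<mu>)"
    by (intro Bochner_Integration.integral_cong) (auto simp: space_mu)
  then show ?thesis
    using assms(1,2) unfolding diff_under_integral_def by metis
qed

text \<open>The mean \<open>\<integral> P\<^sub>s f d\<mu>\<close> is constant, so its derivative \<open>\<integral> L P\<^sub>0 f d\<mu>\<close> at \<open>s = 0\<close> vanishes. Rather than
  deriving \<open>P\<^sub>0 f = f\<close> from the law of the first jump time, the proof uses \<open>L P\<^sub>0 f = P\<^sub>0 L f\<close> and
  the invariance of \<open>\<mu>\<close> a second time.\<close>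
lemma integral_generator:
  assumes "f \<in> \<A>"
  shows "(\<integral>x. L f x \<partial>\<mu>) = 0"
proof -
  have "((\<lambda>s. \<integral>x. P s f x \<partial>\<mu>) has_real_derivative (\<integral>x. L (P 0 f) x \<partial>\<mu>)) (at 0 within {0..})"
    using under_mu[OF assms] time_deriv[OF assms, THEN conjunct1]
    by (intro has_derivative_under_integral) auto
  moreover have "((\<lambda>s. \<integral>x. P s f x \<partial>\<mu>) has_real_derivative 0) (at 0 within {0..})"
    by (rule has_field_derivative_transform_within[OF DERIV_const[of "\<integral>x. f x \<partial>\<mu>"] zero_less_one])
       (auto simp: integral_transition[OF assms])
  ultimately have "(\<integral>x. L (P 0 f) x \<partial>\<mu>) = 0"
    using vector_derivative_within[OF at_within_Ici_neq_bot[of 0]]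
    unfolding has_real_derivative_iff_has_vector_derivative by (metis order_refl)
  also have "(\<integral>x. L (P 0 f) x \<partial>\<mu>) = (\<integral>x. P 0 (L f) x \<partial>\<mu>)"
    using time_deriv[OF assms] by (intro Bochner_Integration.integral_cong) (auto simp: space_mu)
  also have "\<dots> = (\<integral>x. L f x \<partial>\<mu>)"
    by (intro integral_transition L_closed assms) simp
  finally show ?thesis .
qed

section \<open>The Bakry-Emery computation\<close>

lemma kernel_prob:
  assumes "x \<in> \<Omega>"
  shows "prob_space (Q x)"
  using measurable_space[OF markov_kernel, of x] assms
  by (simp add: space_restrict_space space_prob_algebra)

text \<open>The difference of the two sides is the variance of \<open>f\<close> under \<open>Q x\<close>.\<close>
lemma square_kernel_op_le:
  assumes "f \<in> \<A>" "x \<in> \<Omega>"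
  shows "(kernel_op Q f x)\<^sup>2 \<le> kernel_op Q (\<lambda>y. (f y)\<^sup>2) x"
proof -
  interpret Qx: prob_space "Q x" using kernel_prob[OF assms(2)] .
  have "0 \<le> Qx.variance f" by simp
  also have "Qx.variance f = Qx.expectation (\<lambda>y. (f y)\<^sup>2) - (Qx.expectation f)\<^sup>2"
    using Q_defined square_closed assms by (intro Qx.variance_eq) auto
  finally show ?thesis by (simp add: kernel_op_def)
qed

lemma field_differentiable:
  assumes "x \<in> \<Omega>"
  shows "(\<lambda>y. b y $ k) differentiable (at x)"
  using smooth_field[of k] assms unfolding smooth_on_def by (metis iter_partial.simps(1))

lemma rate_differentiable:
  assumes "x \<in> \<Omega>"
  shows "lam differentiable (at x)"
  using smooth_rate assms unfolding smooth_on_def by (metis iter_partial.simps(1))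

lemma Jac_component:
  assumes "x \<in> \<Omega>"
  shows "Jac b x $ i $ k = partial i (\<lambda>y. b y $ k) x"
proof -
  have "b differentiable (at x)"
    using field_differentiable[OF assms]
    by (subst differentiable_componentwise_within) (auto simp: Basis_vec_def inner_axis)
  then have "(b has_derivative frechet_derivative b (at x)) (at x)"
    by (simp add: frechet_derivative_works)
  then have "((\<lambda>y. b y $ k) has_derivative (\<lambda>h. frechet_derivative b (at x) h $ k)) (at x)"
    by (rule bounded_linear.has_derivative[OF bounded_linear_vec_nth])
  from partial_eqI[OF this] show ?thesis
    by (simp add: Jac_def transpose_def jacobian_def matrix_def)
qed

text \<open>The Hessian term is written with \<open>\<partial>\<^sub>k \<partial>\<^sub>i f\<close> rather than \<open>\<partial>\<^sub>i \<partial>\<^sub>k f\<close>, so that it is the same term as in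
  \<open>generator_norm_grad\<close> and cancels against it.\<close>
lemma grad_generator:
  assumes f: "f \<in> \<A>" and x: "x \<in> \<Omega>"
  shows "grad (L f) x = Jac b x *v grad f x + (\<chi> i. \<Sum>k\<in>UNIV. b x $ k * partial k (partial i f) x)
    + (kernel_op Q f x - f x) *\<^sub>R grad lam x + lam x *\<^sub>R (grad (kernel_op Q f) x - grad f x)"
proof -
  have df: "f differentiable (at x)" "kernel_op Q f differentiable (at x)"
      "partial k f differentiable (at x)" for k
    using poly_smooth_differentiable[OF _ x] f Q_closed poly_smooth_partial by blast+
  have "partial i (L f) x = (Jac b x *v grad f x) $ i + (\<Sum>k\<in>UNIV. b x $ k * partial k (partial i f) x)
    + (kernel_op Q f x - f x) * partial i lam x + lam x * (partial i (kernel_op Q f) x - partial i f x)" for i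
  proof -
    have "L f = (\<lambda>y. (\<Sum>k\<in>UNIV. b y $ k * partial k f y) + lam y * (kernel_op Q f y - f y))"
      by (simp add: fun_eq_iff generator_def inner_vec_def grad_def)
    then have "partial i (L f) x =
        (\<Sum>k\<in>UNIV. b x $ k * partial i (partial k f) x + partial i (\<lambda>y. b y $ k) x * partial k f x)
        + (lam x * (partial i (kernel_op Q f) x - partial i f x) + partial i lam x * (kernel_op Q f x - f x))"
      using df field_differentiable[OF x] rate_differentiable[OF x]
      by (simp add: partial_add partial_sum partial_mult partial_diff differentiable_add
          differentiable_diff differentiable_mult differentiable_sum)
    moreover have "partial i (partial k f) x = partial k (partial i f) x" for k
      using f by (intro partial_commute[OF open_domain x]) (simp add: poly_smooth_def)
    ultimately show ?thesis
      by (simp add: sum.distrib matrix_vector_mult_def Jac_component[OF x] grad_def mult.commute)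
  qed
  then show ?thesis
    by (simp add: vec_eq_iff grad_def)
qed

lemma generator_norm_grad:
  assumes f: "f \<in> \<A>" and x: "x \<in> \<Omega>"
  shows "L (\<lambda>y. (norm (grad f y))\<^sup>2) x = 2 * (grad f x \<bullet> (\<chi> i. \<Sum>k\<in>UNIV. b x $ k * partial k (partial i f) x))
    + lam x * (kernel_op Q (\<lambda>y. (norm (grad f y))\<^sup>2) x - (norm (grad f x))\<^sup>2)"
proof -
  have df: "partial i f differentiable (at x)" for i
    using poly_smooth_differentiable[OF _ x] f poly_smooth_partial by blast
  have "partial k (\<lambda>y. (norm (grad f y))\<^sup>2) x = (\<Sum>i\<in>UNIV. 2 * (partial i f x * partial k (partial i f) x))" for k
  proof -
    have "(\<lambda>y. (norm (grad f y))\<^sup>2) = (\<lambda>y. \<Sum>i\<in>UNIV. partial i f y * partial i f y)"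
      by (simp add: power2_norm_eq_inner inner_vec_def grad_def)
    then show ?thesis
      using df by (simp add: partial_sum partial_mult differentiable_mult)
  qed
  then have "b x \<bullet> grad (\<lambda>y. (norm (grad f y))\<^sup>2) x
      = (\<Sum>k\<in>UNIV. \<Sum>i\<in>UNIV. 2 * (partial i f x * (b x $ k * partial k (partial i f) x)))"
    by (simp add: inner_vec_def grad_def sum_distrib_left mult_ac)
  also have "\<dots> = (\<Sum>i\<in>UNIV. \<Sum>k\<in>UNIV. 2 * (partial i f x * (b x $ k * partial k (partial i f) x)))"
    by (rule sum.swap)
  also have "\<dots> = 2 * (grad f x \<bullet> (\<chi> i. \<Sum>k\<in>UNIV. b x $ k * partial k (partial i f) x))"
    by (simp add: inner_vec_def grad_def sum_distrib_left)
  finally show ?thesis by (simp add: generator_def)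
qed

lemma generator_square:
  assumes f: "f \<in> \<A>" and x: "x \<in> \<Omega>"
  shows "L (\<lambda>y. (f y)\<^sup>2) x - 2 * f x * L f x
    = lam x * (kernel_op Q (\<lambda>y. (f y)\<^sup>2) x - 2 * f x * kernel_op Q f x + (f x)\<^sup>2)"
proof -
  have "partial i (\<lambda>y. (f y)\<^sup>2) x = 2 * f x * partial i f x" for i
    using poly_smooth_differentiable[OF f x] by (simp add: power2_eq_square partial_mult)
  then have "grad (\<lambda>y. (f y)\<^sup>2) x = (2 * f x) *\<^sub>R grad f x"
    by (simp add: vec_eq_iff grad_def)
  then show ?thesis
    by (simp add: generator_def algebra_simps power2_eq_square)
qed

text \<open>A coordinate function has a gradient of norm \<open>1\<close>, and \<open>Q\<close> preserves constants, so it turns the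
  hypothesis into a bound of a square by \<open>m\<close>.\<close>
lemma jump_gradient_factor_nonneg:
  assumes jump_gradient: "\<forall>f\<in>\<A>. (norm (grad (kernel_op Q f) x))\<^sup>2 \<le> m * kernel_op Q (\<lambda>y. (norm (grad f y))\<^sup>2) x"
    and x: "x \<in> \<Omega>"
  shows "0 \<le> m"
proof -
  interpret Qx: prob_space "Q x" using kernel_prob[OF x] .
  fix j :: 'd
  have "grad (\<lambda>y. y $ j) y = axis j 1" for y :: "real^'d"
    by (simp add: grad_def partial_component axis_def vec_eq_iff)
  then have "kernel_op Q (\<lambda>y. (norm (grad (\<lambda>y. y $ j) y))\<^sup>2) x = 1"
    by (simp add: kernel_op_def Qx.prob_space)
  then have "(norm (grad (kernel_op Q (\<lambda>y. y $ j)) x))\<^sup>2 \<le> m"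
    using jump_gradient poly_smooth_component[OF open_domain, of j] by fastforce
  then show ?thesis
    by (rule order_trans[OF zero_le_power2])
qed

text \<open>The heart of the argument. The facts \<open>jump\<close>, \<open>rate\<close> and \<open>variance\<close> bound the three terms of the
  expansion that involve \<open>Q\<close>: the contraction of gradients by \<open>Q\<close>, Young's inequality with weight
  \<open>\<beta> \<lambda>\<close>, and the dissipation of the variance that pays for the term \<open>\<beta> \<lambda> (Q f - f)\<^sup>2\<close>
  left over by Young's inequality.\<close>
lemma dissipation_pointwise:
  assumes f: "f \<in> \<A>" and x: "x \<in> \<Omega>" and beta_pos: "\<beta> > 0" and rate_pos: "lam x > 0"
    and jump_gradient: "\<forall>f\<in>\<A>. (norm (grad (kernel_op Q f) x))\<^sup>2 \<le> m * kernel_op Q (\<lambda>y. (norm (grad f y))\<^sup>2) x"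
    and curvature: "\<And>u. u \<bullet> ((2 *\<^sub>R Jac b x + (1 / (\<beta> * lam x)) *\<^sub>R outer (grad lam x) (grad lam x)) *v u)
            + lam x * (m - 1) * (norm u)\<^sup>2 \<le> - \<eta> * (norm u)\<^sup>2"
  shows "(2 * (grad f x \<bullet> grad (L f) x) - L (\<lambda>y. (norm (grad f y))\<^sup>2) x)
    + \<beta> * (2 * (f x * L f x) - L (\<lambda>y. (f y)\<^sup>2) x) \<le> - \<eta> * (norm (grad f x))\<^sup>2"
proof -
  let ?g = "grad f x" and ?q = "grad (kernel_op Q f) x" and ?l = "grad lam x"
  let ?d = "kernel_op Q f x - f x" and ?N = "kernel_op Q (\<lambda>y. (norm (grad f y))\<^sup>2) x"
  have N: "0 \<le> ?N"
    unfolding kernel_op_def by (intro Bochner_Integration.integral_nonneg) simp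
  have m: "0 \<le> m"
    by (rule jump_gradient_factor_nonneg[OF jump_gradient x])
  have expand: "2 * (?g \<bullet> grad (L f) x) - L (\<lambda>y. (norm (grad f y))\<^sup>2) x
      = 2 * (?g \<bullet> (Jac b x *v ?g)) + 2 * ?d * (?g \<bullet> ?l) + lam x * (2 * (?g \<bullet> ?q)) - lam x * (norm ?g)\<^sup>2 - lam x * ?N"
    unfolding grad_generator[OF f x] generator_norm_grad[OF f x] power2_norm_eq_inner[of "grad f x"]
    by (simp add: inner_add_right inner_diff_right algebra_simps)
  \<comment> \<open>\<open>2 |g| |q| \<le> 2 |g| sqrt (m N) \<le> m |g|\<^sup>2 + N\<close>, by comparing squares; this uses \<open>m \<ge> 0\<close>\<close>
  have jump: "2 * (?g \<bullet> ?q) \<le> m * (norm ?g)\<^sup>2 + ?N"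
  proof -
    have "(2 * (norm ?g * norm ?q))\<^sup>2 = 4 * ((norm ?g)\<^sup>2 * (norm ?q)\<^sup>2)"
      by (simp add: power_mult_distrib)
    also have "\<dots> \<le> 4 * ((norm ?g)\<^sup>2 * (m * ?N))"
      using jump_gradient f by (intro mult_left_mono) auto
    also have "\<dots> = (m * (norm ?g)\<^sup>2 + ?N)\<^sup>2 - (m * (norm ?g)\<^sup>2 - ?N)\<^sup>2"
      by (simp add: power2_eq_square algebra_simps)
    also have "\<dots> \<le> (m * (norm ?g)\<^sup>2 + ?N)\<^sup>2"
      by simp
    finally have "2 * (norm ?g * norm ?q) \<le> m * (norm ?g)\<^sup>2 + ?N"
      using m N by (intro power2_le_imp_le[of "2 * (norm ?g * norm ?q)"]) auto
    then show ?thesis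
      using norm_cauchy_schwarz[of ?g ?q] by linarith
  qed
  have rate: "2 * ?d * (?g \<bullet> ?l) \<le> (?g \<bullet> ?l)\<^sup>2 / (\<beta> * lam x) + \<beta> * (lam x * ?d\<^sup>2)"
  proof -
    have p: "\<beta> * lam x > 0" using beta_pos rate_pos by simp
    have "0 \<le> (?g \<bullet> ?l - \<beta> * lam x * ?d)\<^sup>2 / (\<beta> * lam x)"
      using p by (intro divide_nonneg_pos) auto
    also have "\<dots> = (?g \<bullet> ?l)\<^sup>2 / (\<beta> * lam x) + \<beta> * (lam x * ?d\<^sup>2) - 2 * ?d * (?g \<bullet> ?l)"
      using beta_pos rate_pos by (simp add: field_simps power2_eq_square)
    finally show ?thesis by simp
  qed
  have variance: "lam x * ?d\<^sup>2 \<le> L (\<lambda>y. (f y)\<^sup>2) x - 2 * f x * L f x"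
    unfolding generator_square[OF f x]
    using square_kernel_op_le[OF f x] rate_pos
    by (intro mult_left_mono) (auto simp: power2_diff algebra_simps)
  have curv: "2 * (?g \<bullet> (Jac b x *v ?g)) + (?g \<bullet> ?l)\<^sup>2 / (\<beta> * lam x) + lam x * (m - 1) * (norm ?g)\<^sup>2
      \<le> - \<eta> * (norm ?g)\<^sup>2"
    using curvature[of ?g]
    by (simp add: matrix_vector_mult_add_rdistrib scaleR_matrix_vector_assoc[symmetric]
        inner_add_right outer_quadratic_form)
  have "lam x * (2 * (?g \<bullet> ?q)) \<le> lam x * (m * (norm ?g)\<^sup>2 + ?N)"
    using jump rate_pos by (intro mult_left_mono) auto
  moreover have "lam x * (m * (norm ?g)\<^sup>2 + ?N) = lam x * (m - 1) * (norm ?g)\<^sup>2 + lam x * (norm ?g)\<^sup>2 + lam x * ?N"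
    by (simp add: algebra_simps)
  moreover have "\<beta> * (lam x * ?d\<^sup>2) \<le> - (\<beta> * (2 * (f x * L f x) - L (\<lambda>y. (f y)\<^sup>2) x))"
    using mult_left_mono[OF variance, of \<beta>] beta_pos by (simp add: algebra_simps)
  ultimately show ?thesis
    using expand rate curv by linarith
qed

text \<open>The two terms \<open>L |\<nabla>f|\<^sup>2\<close> and \<open>L f\<^sup>2\<close> of the pointwise inequality integrate to zero.\<close>
lemma dissipation_integrated:
  assumes f: "f \<in> \<A>" and beta_pos: "\<beta> > 0"
    and jump_gradient: "\<forall>f\<in>\<A>. \<forall>x\<in>\<Omega>.
          (norm (grad (kernel_op Q f) x))\<^sup>2 \<le> M x * kernel_op Q (\<lambda>y. (norm (grad f y))\<^sup>2) x"
    and rate_pos: "AE x in \<mu>. lam x > 0"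
    and curvature: "AE x in \<mu>. \<forall>u.
          u \<bullet> ((2 *\<^sub>R Jac b x + (1 / (\<beta> * lam x)) *\<^sub>R outer (grad lam x) (grad lam x)) *v u)
            + lam x * (M x - 1) * (norm u)\<^sup>2 \<le> - \<eta> * (norm u)\<^sup>2"
  shows "(\<integral>x. 2 * (grad f x \<bullet> grad (L f) x) \<partial>\<mu>) + \<beta> * (\<integral>x. 2 * (f x * L f x) \<partial>\<mu>)
    \<le> - \<eta> * (\<integral>x. (norm (grad f x))\<^sup>2 \<partial>\<mu>)"
proof -
  have int: "integrable \<mu> (\<lambda>x. grad f x \<bullet> grad (L f) x)" "integrable \<mu> (\<lambda>x. f x * L f x)"
    "integrable \<mu> (L (\<lambda>y. (norm (grad f y))\<^sup>2))" "integrable \<mu> (L (\<lambda>y. (f y)\<^sup>2))"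
    "integrable \<mu> (\<lambda>x. (norm (grad f x))\<^sup>2)"
    using f
    by (blast intro: integrable_mu poly_smooth_inner_grad poly_smooth_mult L_closed
        norm_grad_closed square_closed open_domain)+
  have "(\<integral>x. (2 * (grad f x \<bullet> grad (L f) x) - L (\<lambda>y. (norm (grad f y))\<^sup>2) x)
      + \<beta> * (2 * (f x * L f x) - L (\<lambda>y. (f y)\<^sup>2) x) \<partial>\<mu>) \<le> (\<integral>x. - \<eta> * (norm (grad f x))\<^sup>2 \<partial>\<mu>)"
  proof (rule integral_mono_AE)
    show "AE x in \<mu>. (2 * (grad f x \<bullet> grad (L f) x) - L (\<lambda>y. (norm (grad f y))\<^sup>2) x)
      + \<beta> * (2 * (f x * L f x) - L (\<lambda>y. (f y)\<^sup>2) x) \<le> - \<eta> * (norm (grad f x))\<^sup>2"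
      using rate_pos curvature AE_space
    proof eventually_elim
      case (elim x)
      then have "x \<in> \<Omega>" by (simp add: space_mu)
      with elim jump_gradient show ?case
        by (intro dissipation_pointwise[OF f _ beta_pos]) auto
    qed
  qed (use int in auto)
  then show ?thesis
    using int integral_generator[OF norm_grad_closed[OF f]] integral_generator[OF square_closed[OF f]]
    by simp
qed

end

section \<open>Decay of the modified energy\<close>

theorem theorem2:
  fixes \<Omega> :: "(real^'d::finite) set"
    and b :: "real^'d \<Rightarrow> real^'d"
    and lam M :: "real^'d \<Rightarrow> real"
    and Q :: "real^'d \<Rightarrow> (real^'d) measure"
    and \<phi> :: "real^'d \<Rightarrow> real \<Rightarrow> real^'d"
    and Pr :: "real^'d \<Rightarrow> 'w measure"
    and X :: "real \<Rightarrow> 'w \<Rightarrow> real^'d"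
    and Y :: "nat \<Rightarrow> 'w \<Rightarrow> real^'d"
    and T :: "nat \<Rightarrow> 'w \<Rightarrow> ennreal"
    and \<mu> :: "(real^'d) measure"
    and c \<eta> \<beta> :: real
  assumes setting: "pdmp_setting \<Omega> b lam Q \<phi> Pr X Y T \<mu>"
    and c_pos: "c > 0"
    and poincare: "\<forall>f\<in>poly_smooth \<Omega>.
          (\<integral>x. (f x)\<^sup>2 \<partial>\<mu>) - (\<integral>x. f x \<partial>\<mu>)\<^sup>2 \<le> c * (\<integral>x. (norm (grad f x))\<^sup>2 \<partial>\<mu>)"
    and eta_pos: "\<eta> > 0"
    and beta_pos: "\<beta> > 0"
    and jump_gradient: "\<forall>f\<in>poly_smooth \<Omega>. \<forall>x\<in>\<Omega>.
          (norm (grad (kernel_op Q f) x))\<^sup>2 \<le> M x * kernel_op Q (\<lambda>y. (norm (grad f y))\<^sup>2) x"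
    and rate_pos: "AE x in \<mu>. lam x > 0"
    and curvature: "AE x in \<mu>. \<forall>u.
          u \<bullet> ((2 *\<^sub>R Jac b x + (1 / (\<beta> * lam x)) *\<^sub>R outer (grad lam x) (grad lam x)) *v u)
            + lam x * (M x - 1) * (norm u)\<^sup>2 \<le> - \<eta> * (norm u)\<^sup>2"
  shows "\<forall>f\<in>poly_smooth \<Omega>.
     let W = (\<lambda>t. \<integral>x. (norm (grad (transition_op Pr X t f) x))\<^sup>2 \<partial>\<mu>);
         V = (\<lambda>t. (\<integral>x. (transition_op Pr X t f x)\<^sup>2 \<partial>\<mu>) - (\<integral>x. transition_op Pr X t f x \<partial>\<mu>)\<^sup>2)
     in \<forall>t\<ge>0. W t + \<beta> * V t \<le> (W 0 + \<beta> * V 0) * exp (- (\<eta> * t / (\<beta> * c + 1)))"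
proof -
  interpret pdmp_setting \<Omega> b lam Q \<phi> Pr X Y T \<mu> by (rule setting)
  define \<kappa> where "\<kappa> = \<eta> / (\<beta> * c + 1)"
  have pos: "\<beta> * c + 1 > 0"
    using beta_pos c_pos by (simp add: add_pos_pos)
  have decay: "W t + \<beta> * V t \<le> (W 0 + \<beta> * V 0) * exp (- (\<eta> * t / (\<beta> * c + 1)))"
    if f: "f \<in> \<A>" and t: "t \<ge> 0"
      and W: "W = (\<lambda>t. \<integral>x. (norm (grad (P t f) x))\<^sup>2 \<partial>\<mu>)"
      and V: "V = (\<lambda>t. (\<integral>x. (P t f x)\<^sup>2 \<partial>\<mu>) - (\<integral>x. P t f x \<partial>\<mu>)\<^sup>2)"
    for f t W V
  proof -
    \<comment> \<open>The mean of \<open>P\<^sub>s f\<close> is replaced by its constant value, which has no time derivative.\<close>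
    define H where "H s = W s + \<beta> * ((\<integral>x. (P s f x)\<^sup>2 \<partial>\<mu>) - (\<integral>x. f x \<partial>\<mu>)\<^sup>2)" for s
    define D where "D s = (\<integral>x. 2 * (grad (P s f) x \<bullet> grad (L (P s f)) x) \<partial>\<mu>)
      + \<beta> * (\<integral>x. 2 * (P s f x * L (P s f) x) \<partial>\<mu>)" for s
    have H_eq: "H s = W s + \<beta> * V s" if "s \<ge> 0" for s
      using integral_transition[OF f that] by (simp add: H_def V)
    have deriv: "(H has_real_derivative D s) (at s within {0..})" if s: "s \<ge> 0" for s
    proof -
      have "(W has_real_derivative (\<integral>x. 2 * (grad (P s f) x \<bullet> grad (L (P s f)) x) \<partial>\<mu>)) (at s within {0..})"
        unfolding W
      proof (rule has_derivative_under_integral[OF _ s])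
        fix x assume x: "x \<in> \<Omega>"
        have "((\<lambda>r. grad (P r f) x \<bullet> grad (P r f) x) has_vector_derivative
            grad (P s f) x \<bullet> grad (L (P s f)) x + grad (L (P s f)) x \<bullet> grad (P s f) x) (at s within {0..})"
          using time_deriv_grad[OF f x s]
          by (intro bounded_bilinear.has_vector_derivative[OF bounded_bilinear_inner])
        then show "((\<lambda>r. (norm (grad (P r f) x))\<^sup>2) has_real_derivative
            2 * (grad (P s f) x \<bullet> grad (L (P s f)) x)) (at s within {0..})"
          by (simp add: has_real_derivative_iff_has_vector_derivative power2_norm_eq_inner inner_commute)
      qed (use under_mu[OF f] in auto)
      moreover have "((\<lambda>r. \<integral>x. (P r f x)\<^sup>2 \<partial>\<mu>) has_real_derivative (\<integral>x. 2 * (P s f x * L (P s f) x) \<partial>\<mu>))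
          (at s within {0..})"
      proof (rule has_derivative_under_integral[OF _ s])
        fix x assume x: "x \<in> \<Omega>"
        show "((\<lambda>r. (P r f x)\<^sup>2) has_real_derivative 2 * (P s f x * L (P s f) x)) (at s within {0..})"
          using time_deriv[OF f x s] by (auto intro!: derivative_eq_intros)
      qed (use under_mu[OF f] in auto)
      ultimately show ?thesis
        unfolding H_def D_def by (auto intro!: derivative_eq_intros)
    qed
    have le: "D s \<le> - \<kappa> * H s" if s: "s \<ge> 0" for s
    proof -
      have Pf: "P s f \<in> \<A>" using P_closed[OF f s] .
      have "D s \<le> - \<eta> * W s"
        unfolding D_def W
        using dissipation_integrated[OF Pf beta_pos jump_gradient rate_pos curvature] .
      moreover have "\<kappa> * H s \<le> \<eta> * W s"
      proof -
        have "V s \<le> c * W s"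
          using poincare Pf by (simp add: V W)
        then have "H s \<le> (\<beta> * c + 1) * W s"
          using mult_left_mono[of "V s" "c * W s" \<beta>] beta_pos H_eq[OF s] by (simp add: algebra_simps)
        then have "\<kappa> * H s \<le> \<kappa> * ((\<beta> * c + 1) * W s)"
          using pos eta_pos by (intro mult_left_mono) (auto simp: \<kappa>_def)
        then show ?thesis using pos by (simp add: \<kappa>_def)
      qed
      ultimately show ?thesis by linarith
    qed
    have "H t \<le> H 0 * exp (- \<kappa> * t)"
      by (rule exp_decay_of_deriv_le[OF deriv le t])
    then show ?thesis
      using H_eq[OF t] H_eq[of 0] by (simp add: \<kappa>_def)
  qed
  show ?thesis
    unfolding Let_def using decay by blast
qed

end
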